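(* Let $n\geq2$, set $d=n-2$, and let $P_n(t)=\sum_{j=0}^dt^j$ be the $\mathbb F_2$-Poincaré polynomial of $\mathbb RP^d$. There is a polynomial $Q_n^+(t)\in\mathbb Z_{\geq0}[t]$ such that $$M_n^+(t)=P_n(t)+(1+t)Q_n^+(t).$$ For $n\geq3$, define $Q_n^-(t)=t^{d-1}Q_n^+(t^{-1})$; for $n=2$, set $Q_2^-=0$. Then $$M_n^-(t)=P_n(t)+(1+t)Q_n^-(t).$$ Moreover, $2Q_n^\pm(1)=R_n-n$ and $M_n^\pm(-1)=\chi(\mathbb RP^{n-2})$. In particular, $$M_n^-(t)=t^{n-2}M_n^+(t^{-1}),\qquad Q_n^-(t)=t^{n-3}Q_n^+(t^{-1})\quad(n\geq3).$$
   Context: $R_n=\frac{3^n-2^{n+1}+3}{2}$, $$M_n^+(t)=\frac{(1+2t)^n-2(1+t)^n+1}{2t^2}=\sum_{q=0}^{n-2}\binom n{q+2}(2^{q+1}-1)t^q,$$ $$M_n^-(t)=\frac{(t+2)^n-2(t+1)^n+t^n}{2}=\sum_{r=0}^{n-2}\binom nr(2^{n-r-1}-1)t^r.$$ ($M_n^+$ is the Morse polynomial, for $p>2$, and $M_n^-$ the generating polynomial of local critical groups, for $1<p<2$, of the reduced Rayleigh quotient $[\bar x]\mapsto\sum_{i<j}|x_i-x_j|^p/\min_c\sum_i|x_i+c|^p$ of the uniformly weighted complete graph $K_n$ on $\mathbb P(\mathbb R^n/\mathbb R(1,\dots,1))\cong\mathbb RP^{n-2}$.) $\chi$ is the Euler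 characteristic. *)

theory Defs
  imports
    "HOL-Homology.Homology"
    "HOL-Computational_Algebra.Polynomial"
begin

definition R_num :: "nat \<Rightarrow> real" where
  "R_num n = (3 ^ n - 2 ^ (n + 1) + 3) / 2"

text \<open>The polynomials are given by their coefficients; the closed forms are the lemmas
  \<open>poly_M_plus\<close> and \<open>poly_M_minus\<close> below. All of this is meant for \<open>n \<ge> 2\<close> only, so
  that the subtractions on natural numbers do not truncate.\<close>

definition M_plus :: "nat \<Rightarrow> real poly" where
  "M_plus n = (\<Sum>q = 0..n - 2. monom (real (n choose (q + 2)) * (2 ^ (q + 1) - 1)) q)"

definition M_minus :: "nat \<Rightarrow> real poly" where
  "M_minus n = (\<Sum>r = 0..n - 2. monom (real (n choose r) * (2 ^ (n - r - 1) - 1)) r)"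

definition P_poly :: "nat \<Rightarrow> real poly" where
  "P_poly n = (\<Sum>j = 0..n - 2. monom 1 j)"

lemma poly_M_plus:
  assumes "n \<ge> 2" and "t \<noteq> 0"
  shows "poly (M_plus n) t = ((1 + 2 * t) ^ n - 2 * (1 + t) ^ n + 1) / (2 * t\<^sup>2)"
proof -
  obtain m where m: "n = Suc (Suc m)"
    using assms(1) by (metis add_2_eq_Suc le_Suc_ex)
  have e: "(1 + x) ^ n = (\<Sum>k\<le>n. real (n choose k) * x ^ k)" for x :: real
    using binomial_ring[of x 1 n] by (simp add: add.commute)
  have "(1 + 2 * t) ^ n - 2 * (1 + t) ^ n = (\<Sum>k\<le>n. real (n choose k) * (2 ^ k - 2) * t ^ k)"
    unfolding e by (simp add: sum_distrib_left sum_subtractf[symmetric] power_mult_distrib algebra_simps)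
  also have "\<dots> = - 1 + (\<Sum>k\<le>m. real (n choose (k + 2)) * (2 ^ (k + 2) - 2) * t ^ (k + 2))"
    unfolding m sum.atMost_Suc_shift by (simp add: sum.atMost_Suc_shift del: sum.atMost_Suc)
  also have "(\<Sum>k\<le>m. real (n choose (k + 2)) * (2 ^ (k + 2) - 2) * t ^ (k + 2)) =
      2 * t\<^sup>2 * (\<Sum>k\<le>m. real (n choose (k + 2)) * (2 ^ (k + 1) - 1) * t ^ k)"
    unfolding sum_distrib_left
    by (intro sum.cong) (auto simp: power2_eq_square algebra_simps)
  finally have "(1 + 2 * t) ^ n - 2 * (1 + t) ^ n + 1 = 2 * t\<^sup>2 * poly (M_plus n) t"
    by (simp add: M_plus_def m poly_sum poly_monom atLeast0AtMost)
  with assms show ?thesis by simp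
qed

lemma poly_M_minus:
  assumes "n \<ge> 2"
  shows "poly (M_minus n) t = ((t + 2) ^ n - 2 * (t + 1) ^ n + t ^ n) / 2"
proof -
  obtain m where m: "n = Suc (Suc m)"
    using assms(1) by (metis add_2_eq_Suc le_Suc_ex)
  have "(t + 2) ^ n - 2 * (t + 1) ^ n = (\<Sum>k\<le>n. real (n choose k) * (2 ^ (n - k) - 2) * t ^ k)"
    unfolding binomial_ring[of t]
    by (simp add: sum_distrib_left sum_subtractf[symmetric] algebra_simps)
  also have "\<dots> = (\<Sum>k\<le>m. real (n choose k) * (2 ^ (n - k) - 2) * t ^ k) - t ^ n"
    by (simp add: m)
  also have "(\<Sum>k\<le>m. real (n choose k) * (2 ^ (n - k) - 2) * t ^ k) =
      2 * (\<Sum>k\<le>m. real (n choose k) * (2 ^ (n - k - 1) - 1) * t ^ k)"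
    unfolding sum_distrib_left
    by (intro sum.cong) (auto simp: m Suc_diff_le algebra_simps)
  finally show ?thesis
    by (simp add: M_minus_def m poly_sum poly_monom atLeast0AtMost)
qed

text \<open>\<open>nsphere d\<close> is the unit sphere of \<open>\<real>\<^sup>d\<^sup>+\<^sup>1\<close>, realised as functions \<open>nat \<Rightarrow> real\<close> that vanish at
  all indices above \<open>d\<close>. Real projective space is its quotient by the antipodal map, with the
  quotient topology.\<close>

definition antipodal_class :: "(nat \<Rightarrow> real) \<Rightarrow> (nat \<Rightarrow> real) set" where
  "antipodal_class x = {x, (\<lambda>i. - x i)}"

definition real_projective_space :: "nat \<Rightarrow> (nat \<Rightarrow> real) set topology" where
  "real_projective_space d = topology (\<lambda>U. U \<subseteq> antipodal_class ` topspace (nsphere d) \<and>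
     openin (nsphere d) {x \<in> topspace (nsphere d). antipodal_class x \<in> U})"

lemma openin_real_projective_space:
  "openin (real_projective_space d) U \<longleftrightarrow> U \<subseteq> antipodal_class ` topspace (nsphere d) \<and>
     openin (nsphere d) {x \<in> topspace (nsphere d). antipodal_class x \<in> U}"
proof -
  let ?S = "topspace (nsphere d)"
  have "istopology (\<lambda>U. U \<subseteq> antipodal_class ` ?S \<and>
          openin (nsphere d) {x \<in> ?S. antipodal_class x \<in> U})"
    unfolding istopology_def
  proof (intro conjI allI impI)
    fix U V
    assume "U \<subseteq> antipodal_class ` ?S \<and> openin (nsphere d) {x \<in> ?S. antipodal_class x \<in> U}"
      and "V \<subseteq> antipodal_class ` ?S \<and> openin (nsphere d) {x \<in> ?S. antipodal_class x \<in> V}"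
    moreover have "{x \<in> ?S. antipodal_class x \<in> U \<inter> V} =
        {x \<in> ?S. antipodal_class x \<in> U} \<inter> {x \<in> ?S. antipodal_class x \<in> V}" by auto
    ultimately show "U \<inter> V \<subseteq> antipodal_class ` ?S"
      and "openin (nsphere d) {x \<in> ?S. antipodal_class x \<in> U \<inter> V}" by auto
  next
    fix \<K>
    assume *: "\<forall>K\<in>\<K>. K \<subseteq> antipodal_class ` ?S \<and> openin (nsphere d) {x \<in> ?S. antipodal_class x \<in> K}"
    then show "\<Union> \<K> \<subseteq> antipodal_class ` ?S" by auto
    have "{x \<in> ?S. antipodal_class x \<in> \<Union> \<K>} = (\<Union>K\<in>\<K>. {x \<in> ?S. antipodal_class x \<in> K})" by auto
    with * show "openin (nsphere d) {x \<in> ?S. antipodal_class x \<in> \<Union> \<K>}" by auto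
  qed
  then show ?thesis
    unfolding real_projective_space_def by (simp add: topology_inverse')
qed

lemma topspace_real_projective_space:
  "topspace (real_projective_space d) = antipodal_class ` topspace (nsphere d)"
proof -
  have "{x \<in> topspace (nsphere d). antipodal_class x \<in> antipodal_class ` topspace (nsphere d)}
      = topspace (nsphere d)" by auto
  then have "openin (real_projective_space d) (antipodal_class ` topspace (nsphere d))"
    by (simp add: openin_real_projective_space)
  moreover have "topspace (real_projective_space d) \<subseteq> antipodal_class ` topspace (nsphere d)"
    using openin_topspace[of "real_projective_space d"]
    unfolding openin_real_projective_space by blast
  ultimately show ?thesis
    using openin_subset by blast
qed

lemma quotient_map_antipodal_class:
  "quotient_map (nsphere d) (real_projective_space d) antipodal_class"
  unfolding quotient_map_def topspace_real_projective_space openin_real_projective_space by auto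

text \<open>The rank of an abelian group: the largest size of a finite \<open>\<int>\<close>-linearly independent subset.
  It is only meaningful for groups of finite rank, because \<open>Sup\<close> of an unbounded set of natural
  numbers is unspecified.\<close>

definition int_independent :: "('a, 'b) monoid_scheme \<Rightarrow> 'a set \<Rightarrow> bool" where
  "int_independent G B \<longleftrightarrow> finite B \<and> B \<subseteq> carrier G \<and>
     (\<forall>c :: 'a \<Rightarrow> int. (\<Otimes>\<^bsub>G\<^esub>b\<in>B. b [^]\<^bsub>G\<^esub> c b) = \<one>\<^bsub>G\<^esub> \<longrightarrow> (\<forall>b\<in>B. c b = 0))"

definition abelian_group_rank :: "('a, 'b) monoid_scheme \<Rightarrow> nat" where
  "abelian_group_rank G = Sup {card B | B. int_independent G B}"

definition betti_number :: "nat \<Rightarrow> 'a topology \<Rightarrow> nat" where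
  "betti_number k X = abelian_group_rank (homology_group (int k) X)"

text \<open>The alternating sum of the ranks of the singular homology groups, for spaces in which these
  ranks are finite and almost all of them vanish.\<close>

definition euler_characteristic :: "'a topology \<Rightarrow> int" where
  "euler_characteristic X = (\<Sum>k | betti_number k X \<noteq> 0. (- 1) ^ k * int (betti_number k X))"

end

theory Submission
  imports Defs "HOL-Analysis.Abstract_Topological_Spaces"
begin

text \<open>The polynomial identities come from a recursion for the cofactor \<open>Q\<^sup>+\<close>, which exhibits it as a
  polynomial with coefficients in the natural numbers, and from the reflection
  \<open>t \<mapsto> 1 / t\<close>, which exchanges the two families. The Euler characteristic of projective space is
  computed by induction on the dimension: projective \<open>d\<close>-space minus a point retracts onto projective
  \<open>(d - 1)\<close>-space, and by excision the relative homology of this pair is that of the pair formed by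
  the \<open>d\<close>-sphere and the sphere minus a point, hence infinite cyclic in degree \<open>d\<close> and zero in all
  other degrees. The connecting map in degree \<open>d\<close> need not be determined: whether it is zero or
  injective, the alternating sum of the ranks changes by \<open>(-1)\<^sup>d\<close>.\<close>

section \<open>Ranks of abelian groups\<close>

lemma (in group_hom) hom_finprod:
  assumes "comm_group G" "comm_group H" "finite B" "g \<in> B \<rightarrow> carrier G"
  shows "h (finprod G g B) = finprod H (\<lambda>b. h (g b)) B"
proof -
  interpret G: comm_group G by fact
  interpret H: comm_group H by fact
  show ?thesis
    using assms(3,4) by (induction B rule: finite_induct) (auto simp: Pi_iff)
qed

text \<open>A relation among the images is the image of a relation in \<open>G\<close> with the same
  exponents, and injectivity of \<open>h\<close> pulls it back.\<close>

lemma int_independent_image: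
  fixes G :: "('a, 'c) monoid_scheme" and H :: "('b, 'd) monoid_scheme"
  assumes h: "h \<in> iso G H" and G: "comm_group G" and H: "comm_group H" and B: "int_independent G B"
  shows "int_independent H (h ` B) \<and> card (h ` B) = card B"
proof -
  interpret G: comm_group G by fact
  interpret H: comm_group H by fact
  interpret h: group_hom G H h
    using h by unfold_locales (simp add: iso_def)
  have fin: "finite B" and sub: "B \<subseteq> carrier G"
    and ind: "\<And>c :: 'a \<Rightarrow> int. (\<Otimes>\<^bsub>G\<^esub>b\<in>B. b [^]\<^bsub>G\<^esub> c b) = \<one>\<^bsub>G\<^esub> \<Longrightarrow> \<forall>b\<in>B. c b = 0"
    using B by (auto simp: int_independent_def)
  have car: "b \<in> carrier G" if "b \<in> B" for b
    using sub that by blast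
  have inj: "inj_on h (carrier G)"
    using h by (simp add: iso_def bij_betw_def)
  then have injB: "inj_on h B"
    using sub inj_on_subset by blast
  have "\<forall>b\<in>h ` B. c b = 0" if c: "(\<Otimes>\<^bsub>H\<^esub>b\<in>h ` B. b [^]\<^bsub>H\<^esub> c b) = \<one>\<^bsub>H\<^esub>" for c :: "'b \<Rightarrow> int"
  proof -
    have "(\<Otimes>\<^bsub>H\<^esub>b\<in>h ` B. b [^]\<^bsub>H\<^esub> c b) = (\<Otimes>\<^bsub>H\<^esub>b\<in>B. h b [^]\<^bsub>H\<^esub> c (h b))"
      using injB car by (intro H.finprod_reindex) auto
    also have "\<dots> = (\<Otimes>\<^bsub>H\<^esub>b\<in>B. h (b [^]\<^bsub>G\<^esub> c (h b)))"
      using car by (intro H.finprod_cong') (auto simp: h.hom_int_pow)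
    also have "\<dots> = h (\<Otimes>\<^bsub>G\<^esub>b\<in>B. b [^]\<^bsub>G\<^esub> c (h b))"
      using car fin by (subst h.hom_finprod[OF G H]) auto
    finally have "h (\<Otimes>\<^bsub>G\<^esub>b\<in>B. b [^]\<^bsub>G\<^esub> c (h b)) = h \<one>\<^bsub>G\<^esub>"
      using c by simp
    then have "(\<Otimes>\<^bsub>G\<^esub>b\<in>B. b [^]\<^bsub>G\<^esub> c (h b)) = \<one>\<^bsub>G\<^esub>"
      using car by (intro inj_onD[OF inj]) (auto intro!: G.finprod_closed)
    from ind[OF this] show ?thesis
      by blast
  qed
  then show ?thesis
    using fin car injB by (auto simp: int_independent_def card_image)
qed

lemma int_independent_transfer:
  assumes "G \<cong> H" "comm_group G" "comm_group H" "int_independent G B"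
  shows "\<exists>C. card B = card C \<and> int_independent H C"
  using assms int_independent_image by (metis ex_in_conv is_iso_def)

lemma abelian_group_rank_iso:
  assumes "G \<cong> H" "comm_group G" "comm_group H"
  shows "abelian_group_rank G = abelian_group_rank H"
proof -
  have "H \<cong> G"
    using assms by (simp add: comm_group_def group.iso_sym)
  then have "{card B |B. int_independent G B} = {card B |B. int_independent H B}"
    using int_independent_transfer[of G H] int_independent_transfer[of H G] assms by blast
  then show ?thesis
    by (simp add: abelian_group_rank_def)
qed

text \<open>A torsion element satisfies a nontrivial relation on its own, so no independent set has
  a member.\<close>

lemma abelian_group_rank_torsion:
  assumes "comm_group G" and torsion: "\<And>x. x \<in> carrier G \<Longrightarrow> \<exists>k :: int. k \<noteq> 0 \<and> x [^]\<^bsub>G\<^esub> k = \<one>\<^bsub>G\<^esub>"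
  shows "abelian_group_rank G = 0"
proof -
  interpret comm_group G by fact
  have empty: "B = {}" if B: "int_independent G B" for B
  proof (rule ccontr)
    assume "B \<noteq> {}"
    then obtain b where b: "b \<in> B" by blast
    then have "b \<in> carrier G"
      using B unfolding int_independent_def by blast
    then obtain k :: int where k: "k \<noteq> 0" "b [^]\<^bsub>G\<^esub> k = \<one>\<^bsub>G\<^esub>"
      using torsion by blast
    define c where "c x = (if x = b then k else 0)" for x
    have "(\<Otimes>\<^bsub>G\<^esub>x\<in>B. x [^]\<^bsub>G\<^esub> c x) = \<one>\<^bsub>G\<^esub>"
      using k by (intro finprod_one_eqI) (simp add: c_def)
    then have "c b = 0"
      using B b unfolding int_independent_def by blast
    with k show False
      by (simp add: c_def)
  qed
  have "{card B |B. int_independent G B} \<subseteq> {0}"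
  proof
    fix k
    assume "k \<in> {card B |B. int_independent G B}"
    then obtain B where "k = card B" "int_independent G B"
      by blast
    then show "k \<in> {0}"
      using empty[of B] by simp
  qed
  \<comment> \<open>Both cases give 0, because \<open>Sup {} = 0\<close> on the natural
    numbers.\<close>
  then have "{card B |B. int_independent G B} = {} \<or> {card B |B. int_independent G B} = {0}"
    by (rule subset_singletonD)
  then show ?thesis
    unfolding abelian_group_rank_def by (elim disjE) (simp_all only: Sup_nat_empty cSup_singleton)
qed

lemma abelian_group_rank_trivial:
  assumes "comm_group G" "trivial_group G"
  shows "abelian_group_rank G = 0"
proof (rule abelian_group_rank_torsion)
  fix x
  assume "x \<in> carrier G"
  then have "x [^]\<^bsub>G\<^esub> (1 :: int) = \<one>\<^bsub>G\<^esub>"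
    using assms by (auto simp: trivial_group_def group.int_pow_one)
  then show "\<exists>k :: int. k \<noteq> 0 \<and> x [^]\<^bsub>G\<^esub> k = \<one>\<^bsub>G\<^esub>"
    by (intro exI[of _ 1]) simp
qed fact

lemma (in comm_group) finprod_int_pow_pair:
  fixes c :: "'a \<Rightarrow> int"
  assumes "finite B" "B \<subseteq> carrier G" "a \<in> B" "b \<in> B" "a \<noteq> b" "\<And>x. x \<in> B - {a, b} \<Longrightarrow> c x = 0"
  shows "(\<Otimes>x\<in>B. x [^] c x) = a [^] c a \<otimes> b [^] c b"
proof -
  have "(\<Otimes>x\<in>B. x [^] c x) = (\<Otimes>x\<in>{a, b}. x [^] c x)"
    using assms by (intro finprod_mono_neutral_cong_right) auto
  also have "\<dots> = a [^] c a \<otimes> b [^] c b"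
    using assms by (subst finprod_insert) (auto simp: subset_iff)
  finally show ?thesis .
qed

text \<open>\<open>G\<close> is in effect a nonzero subgroup of the integers: two of its elements
  are always dependent, and one nonzero element is independent by torsion-freeness.\<close>

lemma abelian_group_rank_mon_integer_group:
  fixes G (structure)
  assumes "comm_group G" and f: "f \<in> mon G integer_group" and "\<not> trivial_group G"
  shows "abelian_group_rank G = 1"
proof -
  interpret comm_group G by fact
  interpret f: group_hom G integer_group f
    using f by (simp add: group_hom_def group_hom_axioms_def mon_def)
  have inj: "inj_on f (carrier G)"
    using f by (simp add: mon_def)
  have f0: "f x \<noteq> 0" if "x \<in> carrier G" "x \<noteq> \<one>" for x
    using that inj_onD[OF inj, of x \<one>] f.hom_one by auto
  have pow: "f (x [^] c) = c * f x" if "x \<in> carrier G" for x and c :: int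
    using that by (simp add: f.hom_int_pow)
  have le: "card B \<le> 1" if B: "int_independent G B" for B
  proof (rule ccontr)
    assume "\<not> card B \<le> 1"
    then obtain a b where ab: "a \<in> B" "b \<in> B" "a \<noteq> b"
      using B by (metis card_le_Suc0_iff_eq int_independent_def One_nat_def)
    have sub: "finite B" "B \<subseteq> carrier G"
      using B by (auto simp: int_independent_def)
    \<comment> \<open>In additive notation this is the relation
      \<open>f b * a - f a * b = 0\<close>. Its coefficients vanish only if
      \<open>f a = f b = 0\<close>, which contradicts \<open>a \<noteq> b\<close>.\<close>
    define c where "c x = (if x = a then f b else if x = b then - f a else 0)" for x
    have car: "a \<in> carrier G" "b \<in> carrier G"
      using ab sub by auto
    have "f (a [^] c a \<otimes> b [^] c b) = f \<one>"
      using car ab(3) by (simp add: pow c_def)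
    then have "a [^] c a \<otimes> b [^] c b = \<one>"
      using car by (intro inj_onD[OF inj]) auto
    then have "(\<Otimes>x\<in>B. x [^] c x) = \<one>"
      using finprod_int_pow_pair[of B a b c] sub ab by (auto simp: c_def)
    then have "c a = 0" "c b = 0"
      using B ab unfolding int_independent_def by blast+
    then show False
      using ab car inj_onD[OF inj, of a b] by (auto simp: c_def)
  qed
  obtain x where x: "x \<in> carrier G" "x \<noteq> \<one>"
    using assms(3) by (auto simp: trivial_group_subset)
  have "c x = 0" if "x [^] c x = \<one>" for c :: "'a \<Rightarrow> int"
    using pow[OF x(1), of "c x"] f0[OF x] that f.hom_one by auto
  then have "int_independent G {x}"
    using x by (auto simp: int_independent_def finprod_insert[of "{}"])
  then have mem: "1 \<in> {card B |B. int_independent G B}"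
    by (auto intro!: exI[of _ "{x}"])
  show ?thesis
    unfolding abelian_group_rank_def
    by (rule cSup_eq_maximum[OF mem]) (use le in auto)
qed

text \<open>The middle map \<open>\<delta>\<close> is either zero or injective, since its target is torsion-free.\<close>

lemma rank_exact_integer:
  assumes C: "comm_group C" and Z: "comm_group Z" and B: "comm_group B" and E: "comm_group E"
    and j: "j \<in> mon C Z" and \<delta>: "\<delta> \<in> hom Z B" and g: "g \<in> epi B E"
    and ker_\<delta>: "kernel Z B \<delta> = j ` carrier C" and ker_g: "kernel B E g = \<delta> ` carrier Z"
    and \<phi>: "\<phi> \<in> iso Z integer_group" and f: "f \<in> mon B integer_group"
  shows "abelian_group_rank C + abelian_group_rank B = abelian_group_rank E + 1"
proof -
  interpret C: comm_group C by fact
  interpret Z: comm_group Z by fact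
  interpret B: comm_group B by fact
  interpret E: comm_group E by fact
  interpret j: group_hom C Z j
    using j by unfold_locales (auto simp: mon_def)
  interpret \<delta>: group_hom Z B \<delta>
    using \<delta> by unfold_locales
  interpret g: group_hom B E g
    using g by unfold_locales (auto simp: epi_def)
  interpret f: group_hom B integer_group f
    using f by (simp add: group_hom_def group_hom_axioms_def mon_def)
  interpret \<phi>: group_hom Z integer_group \<phi>
    using \<phi> by (simp add: group_hom_def group_hom_axioms_def iso_def)
  have inj_f: "inj_on f (carrier B)" and inj_j: "inj_on j (carrier C)" and inj_\<phi>: "inj_on \<phi> (carrier Z)"
    using f j \<phi> by (auto simp: mon_def iso_def bij_betw_def)
  have f0: "f x \<noteq> 0" if "x \<in> carrier B" "x \<noteq> \<one>\<^bsub>B\<^esub>" for x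
    using that inj_onD[OF inj_f, of x "\<one>\<^bsub>B\<^esub>"] f.hom_one by auto
  have \<phi>0: "\<phi> x \<noteq> 0" if "x \<in> carrier Z" "x \<noteq> \<one>\<^bsub>Z\<^esub>" for x
    using that inj_onD[OF inj_\<phi>, of x "\<one>\<^bsub>Z\<^esub>"] \<phi>.hom_one by auto
  have \<phi>j: "\<phi> \<circ> j \<in> mon C integer_group"
    using \<phi> by (intro mon_compose[OF j]) (simp add: iso_iff_mon_epi)
  show ?thesis
  proof (cases "trivial_group C")
    case True
    \<comment> \<open>Here \<delta> is injective. Then \<open>B\<close> has rank 1 and
      \<open>E\<close> turns out to be torsion, so the equation reads 0 + 1 = 0 + 1.\<close>
    then have "kernel Z B \<delta> = {\<one>\<^bsub>Z\<^esub>}"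
      unfolding ker_\<delta> by (rule j.image_from_trivial_group)
    then have inj_\<delta>: "inj_on \<delta> (carrier Z)"
      by (simp add: \<delta>.inj_iff_trivial_ker)
    have "\<not> trivial_group Z"
      using \<phi> isomorphic_group_triviality[of Z integer_group] by (auto simp: is_iso_def)
    then obtain z where z: "z \<in> carrier Z" "z \<noteq> \<one>\<^bsub>Z\<^esub>"
      by (auto simp: Z.trivial_group_subset)
    define w where "w = \<delta> z"
    have w: "w \<in> carrier B" "w \<noteq> \<one>\<^bsub>B\<^esub>" "g w = \<one>\<^bsub>E\<^esub>"
    proof -
      show "w \<noteq> \<one>\<^bsub>B\<^esub>"
        using inj_onD[OF inj_\<delta>, of z "\<one>\<^bsub>Z\<^esub>"] z by (auto simp: w_def)
      show "w \<in> carrier B" "g w = \<one>\<^bsub>E\<^esub>"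
        using z(1) ker_g by (auto simp: w_def kernel_def)
    qed
    then have "\<not> trivial_group B"
      by (auto simp: B.trivial_group_subset)
    then have "abelian_group_rank B = 1"
      using abelian_group_rank_mon_integer_group[OF B f] by blast
    moreover have "abelian_group_rank E = 0"
    proof (rule abelian_group_rank_torsion[OF E])
      fix y
      assume "y \<in> carrier E"
      then obtain b where b: "b \<in> carrier B" "y = g b"
        using g by (auto simp: epi_def)
      \<comment> \<open>Elements of a subgroup of the integers have common multiples. As
        \<open>w\<close> lies in the image of \<delta>, the map \<open>g\<close> kills this one,
        which makes \<open>y\<close> torsion with exponent \<open>f w\<close>.\<close>
      have "b [^]\<^bsub>B\<^esub> f w = w [^]\<^bsub>B\<^esub> f b"
        using b w by (intro inj_onD[OF inj_f]) (auto simp: f.hom_int_pow)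
      then have "y [^]\<^bsub>E\<^esub> f w = \<one>\<^bsub>E\<^esub>"
        using b w g.hom_int_pow by (metis E.int_pow_one)
      then show "\<exists>k :: int. k \<noteq> 0 \<and> y [^]\<^bsub>E\<^esub> k = \<one>\<^bsub>E\<^esub>"
        using f0 w by blast
    qed
    ultimately show ?thesis
      using abelian_group_rank_trivial[OF C True] by simp
  next
    case False
    then obtain c where c: "c \<in> carrier C" "c \<noteq> \<one>\<^bsub>C\<^esub>"
      by (auto simp: C.trivial_group_subset)
    define u where "u = j c"
    have u: "u \<in> carrier Z" "u \<noteq> \<one>\<^bsub>Z\<^esub>" "\<delta> u = \<one>\<^bsub>B\<^esub>"
    proof -
      show "u \<noteq> \<one>\<^bsub>Z\<^esub>"
        using inj_onD[OF inj_j, of c "\<one>\<^bsub>C\<^esub>"] c by (auto simp: u_def)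
      show "u \<in> carrier Z" "\<delta> u = \<one>\<^bsub>B\<^esub>"
        using c(1) ker_\<delta> by (auto simp: u_def kernel_def)
    qed
    \<comment> \<open>Now \<delta> kills the nonzero element \<open>u\<close>. Some nonzero multiple
      of \<open>z\<close> is a multiple of \<open>u\<close>, so \<open>\<delta> z\<close> is torsion
      in \<open>B\<close>, which embeds into the integers.\<close>
    have "\<delta> z = \<one>\<^bsub>B\<^esub>" if z: "z \<in> carrier Z" for z
    proof (rule ccontr)
      assume *: "\<delta> z \<noteq> \<one>\<^bsub>B\<^esub>"
      have "z [^]\<^bsub>Z\<^esub> \<phi> u = u [^]\<^bsub>Z\<^esub> \<phi> z"
        using z u by (intro inj_onD[OF inj_\<phi>]) (auto simp: \<phi>.hom_int_pow)
      then have "\<delta> z [^]\<^bsub>B\<^esub> \<phi> u = \<one>\<^bsub>B\<^esub>"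
        using z u \<delta>.hom_int_pow by (metis B.int_pow_one)
      then have "\<phi> u * f (\<delta> z) = 0"
        using z f.hom_int_pow[of "\<delta> z" "\<phi> u"] f.hom_one by simp
      then show False
        using f0[of "\<delta> z"] \<phi>0[of u] z u * by auto
    qed
    \<comment> \<open>With \<delta> zero, \<open>g\<close> is an isomorphism, and the nontrivial
      group \<open>C\<close> has rank 1 because \<open>\<phi> \<circ> j\<close> embeds it into the
      integers.\<close>
    then have "kernel B E g = {\<one>\<^bsub>B\<^esub>}"
      unfolding ker_g using Z.one_closed by (auto simp: image_iff)
    then have "g \<in> iso B E"
      using g by (simp add: iso_def bij_betw_def epi_def flip: g.inj_iff_trivial_ker)
    then have "abelian_group_rank B = abelian_group_rank E"
      using abelian_group_rank_iso[OF is_isoI B E] by blast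
    then show ?thesis
      using abelian_group_rank_mon_integer_group[OF C \<phi>j False] by simp
  qed
qed

section \<open>Punctured spheres and projective spaces\<close>

lemma topspace_nsphere_iff:
  "x \<in> topspace (nsphere n) \<longleftrightarrow> (\<Sum>i\<le>n. (x i)\<^sup>2) = 1 \<and> (\<forall>i>n. x i = 0)"
  by (simp add: nsphere)

lemma topspace_nsphere_minus [simp]:
  "(\<lambda>i. - x i) \<in> topspace (nsphere n) \<longleftrightarrow> x \<in> topspace (nsphere n)"
  by (simp add: topspace_nsphere_iff)

lemma continuous_map_nsphere_antipodal: "continuous_map (nsphere n) (nsphere n) (\<lambda>x i. - x i)"
proof -
  have "continuous_map (nsphere n) (powertop_real UNIV) (\<lambda>x i. - x i)"
    by (auto simp: continuous_map_componentwise_UNIV intro!: continuous_map_minus continuous_map_nsphere_projection)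
  then show ?thesis
    by (subst (2) nsphere) (auto simp: continuous_map_in_subtopology topspace_nsphere_iff)
qed

lemma antipodal_class_eq_iff: "antipodal_class x = antipodal_class y \<longleftrightarrow> x = y \<or> x = (\<lambda>i. - y i)"
  by (auto simp: antipodal_class_def doubleton_eq_iff fun_eq_iff)

lemma antipodal_class_minus [simp]: "antipodal_class (\<lambda>i. - x i) = antipodal_class x"
  by (simp add: antipodal_class_eq_iff)

text \<open>The saturation of an open set is its union with its antipodal image, and the antipodal
  map is continuous.\<close>

lemma open_map_antipodal_class: "open_map (nsphere n) (real_projective_space n) antipodal_class"
  unfolding open_map_def
proof (intro allI impI)
  fix V
  assume V: "openin (nsphere n) V"
  then have sub: "V \<subseteq> topspace (nsphere n)"
    by (rule openin_subset)
  have "{x \<in> topspace (nsphere n). antipodal_class x \<in> antipodal_class ` V} =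
      V \<union> {x \<in> topspace (nsphere n). (\<lambda>i. - x i) \<in> V}"
    (is "?L = ?R")
  proof
    show "?L \<subseteq> ?R"
      by (auto simp: antipodal_class_eq_iff)
    show "?R \<subseteq> ?L"
    proof
      fix x
      assume x: "x \<in> ?R"
      then have "antipodal_class x \<in> antipodal_class ` V"
        using imageI[of "\<lambda>i. - x i" V antipodal_class] by auto
      then show "x \<in> ?L"
        using x sub by auto
    qed
  qed
  then show "openin (real_projective_space n) (antipodal_class ` V)"
    unfolding openin_real_projective_space
    using sub V openin_continuous_map_preimage[OF continuous_map_nsphere_antipodal V]
    by (auto intro!: openin_Un)
qed

text \<open>The source and the map determine the quotient topology. This turns a description of the
  equator as a quotient into an equality of topologies.\<close>

lemma quotient_map_unique_topology:
  assumes "quotient_map X Y f" "quotient_map X Z f"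
  shows "Y = Z"
  using assms unfolding topology_eq quotient_map_def by (metis openin_subset)

text \<open>The unit vector in the direction of the point whose last coordinate is \<open>a\<close> and whose other
  coordinates are those of \<open>b x\<close>. Both homotopies below move along such points.\<close>

definition sphere_slide :: "nat \<Rightarrow> real \<Rightarrow> real \<Rightarrow> (nat \<Rightarrow> real) \<Rightarrow> nat \<Rightarrow> real" where
  "sphere_slide m a b x =
     (\<lambda>i. (if i = Suc m then a else b * x i) / sqrt (a\<^sup>2 + b\<^sup>2 * (1 - (x (Suc m))\<^sup>2)))"

text \<open>The square root in \<open>sphere_slide\<close> is the Euclidean norm of the point before
  scaling, since the other coordinates of \<open>x\<close> have square sum
  \<open>1 - (x (Suc m))\<^sup>2\<close>.\<close>

lemma sphere_slide_in_nsphere: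
  assumes x: "x \<in> topspace (nsphere (Suc m))" and pos: "a\<^sup>2 + b\<^sup>2 * (1 - (x (Suc m))\<^sup>2) > 0"
  shows "sphere_slide m a b x \<in> topspace (nsphere (Suc m))"
proof -
  have "(\<Sum>i\<le>m. (x i)\<^sup>2) = 1 - (x (Suc m))\<^sup>2"
    using x by (simp add: topspace_nsphere_iff)
  then have "(\<Sum>i\<le>m. (b * x i)\<^sup>2) = b\<^sup>2 * (1 - (x (Suc m))\<^sup>2)"
    by (simp add: power_mult_distrib flip: sum_distrib_left)
  moreover have "(\<Sum>i\<le>m. (if i = Suc m then a else b * x i)\<^sup>2) = (\<Sum>i\<le>m. (b * x i)\<^sup>2)"
    by (intro sum.cong) auto
  ultimately have "(\<Sum>i\<le>Suc m. (if i = Suc m then a else b * x i)\<^sup>2) = a\<^sup>2 + b\<^sup>2 * (1 - (x (Suc m))\<^sup>2)"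
    by simp
  then have "(\<Sum>i\<le>Suc m. (sphere_slide m a b x i)\<^sup>2) = 1"
    using pos unfolding sphere_slide_def power_divide
    by (simp del: sum.atMost_Suc flip: sum_divide_distrib)
  then show ?thesis
    using x by (simp add: topspace_nsphere_iff sphere_slide_def)
qed

lemma continuous_map_sphere_slide:
  assumes a: "continuous_map X euclideanreal a" and b: "continuous_map X euclideanreal b"
    and x: "continuous_map X (nsphere (Suc m)) x"
    and pos: "\<And>z. z \<in> topspace X \<Longrightarrow> (a z)\<^sup>2 + (b z)\<^sup>2 * (1 - (x z (Suc m))\<^sup>2) > 0"
  shows "continuous_map X (nsphere (Suc m)) (\<lambda>z. sphere_slide m (a z) (b z) (x z))"
proof -
  have proj: "continuous_map X euclideanreal (\<lambda>z. x z i)" for i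
    using continuous_map_compose[OF x continuous_map_nsphere_projection[of _ i]] by (simp add: o_def)
  have "continuous_map X euclideanreal (\<lambda>z. sphere_slide m (a z) (b z) (x z) i)" for i
    unfolding sphere_slide_def
    using a b proj pos by (cases "i = Suc m") (auto intro!: continuous_intros dest!: pos)
  moreover have "sphere_slide m (a z) (b z) (x z) \<in> topspace (nsphere (Suc m))" if "z \<in> topspace X" for z
    using that continuous_map_image_subset_topspace[OF x] pos
    by (intro sphere_slide_in_nsphere) auto
  ultimately show ?thesis
    by (subst nsphere) (auto simp: continuous_map_in_subtopology continuous_map_componentwise_UNIV topspace_nsphere_iff)
qed

text \<open>A negative \<open>a\<close> gives a nonpositive quotient; otherwise the remaining
  coordinates make the norm exceed \<open>a\<close>. This keeps the contraction below away from the
  north pole.\<close>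

lemma sphere_slide_last_less_1:
  assumes "(x (Suc m))\<^sup>2 \<le> 1" "a < 0 \<or> b\<^sup>2 * (1 - (x (Suc m))\<^sup>2) > 0"
  shows "sphere_slide m a b x (Suc m) < 1"
proof (cases "a < 0")
  case True
  then have "sphere_slide m a b x (Suc m) \<le> 0"
    using assms(1) by (auto simp: sphere_slide_def intro!: divide_nonpos_nonneg)
  then show ?thesis
    by simp
next
  case False
  then have "a < sqrt (a\<^sup>2 + b\<^sup>2 * (1 - (x (Suc m))\<^sup>2))"
    using assms by (intro real_less_rsqrt) simp
  moreover from this False have "sqrt (a\<^sup>2 + b\<^sup>2 * (1 - (x (Suc m))\<^sup>2)) > 0"
    by linarith
  ultimately show ?thesis
    by (simp add: sphere_slide_def divide_less_eq_1_pos)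
qed

text \<open>The sphere without its north pole contracts to the south pole along normalised segments:
  the segment from \<open>x\<close> to the south pole misses the origin, as \<open>x\<close> is not
  the north pole.\<close>

lemma contractible_punctured_nsphere:
  "contractible_space (subtopology (nsphere (Suc m)) {x. x (Suc m) < 1})"
proof -
  let ?X = "subtopology (nsphere (Suc m)) {x. x (Suc m) < 1}"
  \<comment> \<open>On the segment from \<open>x\<close> to the south pole, \<open>?a\<close> is the
    last coordinate and \<open>?b\<close> the factor of the others; \<open>fst z\<close> is the
    time.\<close>
  let ?a = "\<lambda>z :: real \<times> (nat \<Rightarrow> real). (1 - fst z) * snd z (Suc m) - fst z"
  let ?b = "\<lambda>z :: real \<times> (nat \<Rightarrow> real). 1 - fst z"
  let ?h = "\<lambda>z. sphere_slide m (?a z) (?b z) (snd z)"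
  \<comment> \<open>This disjunction serves twice: it makes the norm positive and keeps the image
    away from the north pole.\<close>
  have key: "?a (t, x) < 0 \<or> (?b (t, x))\<^sup>2 * (1 - (x (Suc m))\<^sup>2) > 0"
    if "0 \<le> t" "t \<le> 1" "x \<in> topspace ?X" for t x
  proof (cases "t = 1 \<or> x (Suc m) < 0")
    case True
    then have "?a (t, x) < 0"
    proof
      assume "x (Suc m) < 0"
      with that show ?thesis
        using mult_nonneg_nonpos[of "1 - t" "x (Suc m)"] by (cases "t = 0") auto
    qed simp
    then show ?thesis
      by blast
  next
    case False
    then have "(x (Suc m))\<^sup>2 < 1"
      using that by (auto simp: power_less_one_iff)
    then show ?thesis
      using False by simp
  qed
  have pos: "(?a (t, x))\<^sup>2 + (?b (t, x))\<^sup>2 * (1 - (x (Suc m))\<^sup>2) > 0"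
    if "0 \<le> t" "t \<le> 1" "x \<in> topspace ?X" for t x
  proof -
    have "(x (Suc m))\<^sup>2 \<le> 1"
      using that topspace_nsphere_1[of x "Suc m" "Suc m"] by simp
    then have "(?b (t, x))\<^sup>2 * (1 - (x (Suc m))\<^sup>2) \<ge> 0"
      by simp
    then show ?thesis
      using key[OF that] by (smt (verit) zero_less_power2 zero_le_power2)
  qed
  have less: "sphere_slide m ((1 - t) * x (Suc m) - t) (1 - t) x (Suc m) < 1"
    if "0 \<le> t" "t \<le> 1" "x \<in> topspace (nsphere (Suc m))" "x (Suc m) < 1" for t x
    using that key[of t x] topspace_nsphere_1[of x "Suc m" "Suc m"]
    by (intro sphere_slide_last_less_1) auto
  let ?P = "prod_topology (top_of_set {0..1}) ?X"
  have fst: "continuous_map ?P euclideanreal fst"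
    using continuous_map_into_fulltopology[OF continuous_map_fst] by blast
  have snd: "continuous_map ?P (nsphere (Suc m)) snd"
    using continuous_map_into_fulltopology[OF continuous_map_snd] by blast
  have proj: "continuous_map ?P euclideanreal (\<lambda>z. snd z (Suc m))"
    using continuous_map_compose[OF snd continuous_map_nsphere_projection[of _ "Suc m"]] by (simp add: o_def)
  have "continuous_map ?P (nsphere (Suc m)) ?h"
    using pos by (intro continuous_map_sphere_slide fst snd proj continuous_intros) auto
  then have "continuous_map ?P ?X ?h"
    using less by (auto simp: continuous_map_in_subtopology)
  moreover have "?h (0, x) = x" if "x \<in> topspace ?X" for x
    by (auto simp: sphere_slide_def)
  moreover have "?h (1, x) = (\<lambda>i. if i = Suc m then - 1 else 0)" for x
    by (auto simp: sphere_slide_def)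
  ultimately show ?thesis
    unfolding contractible_space_def
    by (intro exI[of _ "\<lambda>i. if i = Suc m then - 1 else 0"], subst homotopic_with)
      (auto intro!: exI[of _ ?h])
qed

section \<open>The equator and the punctured projective space\<close>

text \<open>The equator is closed and stable under the antipodal map, so the quotient map restricts
  to a quotient map on it.\<close>

lemma real_projective_space_equator:
  "subtopology (real_projective_space (Suc m)) (antipodal_class ` topspace (nsphere m)) =
     real_projective_space m"
proof -
  let ?S = "nsphere (Suc m)" and ?X = "real_projective_space (Suc m)"
  let ?E = "antipodal_class ` topspace (nsphere m)"
  have top: "topspace (nsphere m) = {x \<in> topspace ?S. x (Suc m) = 0}"
    unfolding subtopology_nsphere_equator[of m, symmetric] by auto
  have pre: "{x \<in> topspace ?S. antipodal_class x \<in> ?E} = topspace (nsphere m)"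
    unfolding top by (auto simp: antipodal_class_eq_iff)
  have "closedin ?S {x \<in> topspace ?S. x (Suc m) \<in> {0}}"
    by (intro closedin_continuous_map_preimage[OF continuous_map_nsphere_projection]) simp
  then have "closedin ?S {x \<in> topspace ?S. antipodal_class x \<in> ?E}"
    unfolding pre by (simp add: top)
  moreover have "?E \<subseteq> topspace ?X"
    unfolding topspace_real_projective_space top by blast
  ultimately have "closedin ?X ?E"
    using quotient_map_antipodal_class[of "Suc m"] unfolding quotient_map_closedin by blast
  then have "quotient_map (subtopology ?S (topspace (nsphere m))) (subtopology ?X ?E) antipodal_class"
    by (intro quotient_map_restriction[OF quotient_map_antipodal_class pre]) simp
  also have "subtopology ?S (topspace (nsphere m)) = nsphere m"
    unfolding subtopology_nsphere_equator[of m, symmetric] topspace_subtopology by (metis subtopology_restrict)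
  finally show ?thesis
    by (rule quotient_map_unique_topology) (rule quotient_map_antipodal_class)
qed

text \<open>This is projective space without the class of the two poles. The square makes the
  condition independent of the representative.\<close>

definition punctured_projective :: "nat \<Rightarrow> (nat \<Rightarrow> real) set set" where
  "punctured_projective m = antipodal_class ` {x \<in> topspace (nsphere (Suc m)). (x (Suc m))\<^sup>2 < 1}"

lemma antipodal_class_in_punctured:
  assumes "x \<in> topspace (nsphere (Suc m))"
  shows "antipodal_class x \<in> punctured_projective m \<longleftrightarrow> (x (Suc m))\<^sup>2 < 1"
  using assms by (auto simp: punctured_projective_def antipodal_class_eq_iff)

lemma openin_nsphere_Collect:
  assumes "open V"
  shows "openin (nsphere n) {x \<in> topspace (nsphere n). x k \<in> V}"
  using assms by (intro openin_continuous_map_preimage[OF continuous_map_nsphere_projection]) simp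

lemma closedin_nsphere_Collect:
  assumes "closed V"
  shows "closedin (nsphere n) {x \<in> topspace (nsphere n). x k \<in> V}"
  using assms by (intro closedin_continuous_map_preimage[OF continuous_map_nsphere_projection]) simp

lemma openin_punctured_projective:
  "openin (real_projective_space (Suc m)) (punctured_projective m)"
proof -
  have "open {y :: real. y\<^sup>2 < 1}"
    by (intro open_Collect_less continuous_intros)
  from openin_nsphere_Collect[OF this, of "Suc m" "Suc m"] show ?thesis
    using open_map_antipodal_class by (simp add: punctured_projective_def open_map_def)
qed

text \<open>Multiplying the last coordinate by \<open>t\<close> and normalising commutes with the
  antipodal map, so it descends to a deformation retraction onto the equator, which is reached at
  \<open>t = 0\<close>.\<close>

lemma homology_group_punctured_projective:
  "homology_group p (subtopology (real_projective_space (Suc m)) (punctured_projective m)) \<cong>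
     homology_group p (real_projective_space m)"
proof -
  let ?S = "nsphere (Suc m)" and ?U = "subtopology (real_projective_space (Suc m)) (punctured_projective m)"
  let ?A = "{x \<in> topspace ?S. (x (Suc m))\<^sup>2 < 1}"
  let ?I = "top_of_set {0..1::real}"
  let ?r = "\<lambda>(t, x). sphere_slide m (t * x (Suc m)) 1 x"
  \<comment> \<open>A class is moved by moving both of its members, which avoids choosing a
    representative.\<close>
  let ?H = "\<lambda>(t, c). (\<lambda>x. ?r (t, x)) ` c"
  have topU: "topspace ?U = antipodal_class ` ?A"
    using openin_subset[OF openin_punctured_projective[of m]]
    by (auto simp: punctured_projective_def)
  have pos: "(t * x (Suc m))\<^sup>2 + 1\<^sup>2 * (1 - (x (Suc m))\<^sup>2) > 0" if "x \<in> ?A" for t x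
    using that by (simp add: add_nonneg_pos)
  have odd: "antipodal_class (?r (t, x)) = ?H (t, antipodal_class x)" for t x
    by (auto simp: antipodal_class_def sphere_slide_def fun_eq_iff)
  have quo: "quotient_map (subtopology ?S ?A) ?U antipodal_class"
    using openin_punctured_projective
    by (intro quotient_map_restriction[OF quotient_map_antipodal_class])
      (auto simp: antipodal_class_in_punctured)
  \<comment> \<open>The product with the compact Hausdorff interval is again a quotient map, so the
    homotopy on classes inherits continuity from the one on representatives.\<close>
  have quo_prod: "quotient_map (prod_topology ?I (subtopology ?S ?A)) (prod_topology ?I ?U)
      (\<lambda>(t, x). (t, antipodal_class x))"
    by (intro quotient_map_prod_right quo compact_imp_locally_compact_space)
      (auto simp: Hausdorff_space_subtopology compact_space_subtopology)
  have cont: "continuous_map (prod_topology ?I (subtopology ?S ?A)) ?S ?r"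
  proof -
    let ?P = "prod_topology ?I (subtopology ?S ?A)"
    have fst: "continuous_map ?P euclideanreal fst"
      using continuous_map_into_fulltopology[OF continuous_map_fst] by blast
    have snd: "continuous_map ?P ?S snd"
      using continuous_map_into_fulltopology[OF continuous_map_snd] by blast
    have proj: "continuous_map ?P euclideanreal (\<lambda>z. snd z (Suc m))"
      using continuous_map_compose[OF snd continuous_map_nsphere_projection[of _ "Suc m"]] by (simp add: o_def)
    show ?thesis
      unfolding case_prod_unfold
      using pos by (intro continuous_map_sphere_slide fst snd proj continuous_intros) auto
  qed
  have inA: "?r (t, x) \<in> ?A" if "t \<in> {0..1}" "x \<in> ?A" for t x
  proof -
    have "?r (t, x) \<in> topspace ?S"
      using that pos[of x t] sphere_slide_in_nsphere by simp
    moreover have "(?r (t, x) (Suc m))\<^sup>2 < 1"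
      using that pos[of x t] by (simp add: sphere_slide_def power_divide)
    ultimately show ?thesis
      by simp
  qed
  have "continuous_map (prod_topology ?I (subtopology ?S ?A)) ?U (antipodal_class \<circ> ?r)"
  proof -
    have "continuous_map (prod_topology ?I (subtopology ?S ?A)) (subtopology ?S ?A) ?r"
      using cont inA by (auto simp: continuous_map_in_subtopology)
    then show ?thesis
      using quotient_imp_continuous_map[OF quo] by (rule continuous_map_compose)
  qed
  also have "antipodal_class \<circ> ?r = ?H \<circ> (\<lambda>(t, x). (t, antipodal_class x))"
    using odd by (auto simp: fun_eq_iff)
  finally have contH: "continuous_map (prod_topology ?I ?U) ?U ?H"
    by (rule continuous_compose_quotient_map[OF quo_prod])
  have H1: "?H (1, c) = c" if c: "c \<in> topspace ?U" for c
  proof -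
    obtain x where "x \<in> ?A" "c = antipodal_class x"
      using c unfolding topU by blast
    moreover have "?r (1, x) = x"
      by (auto simp: sphere_slide_def fun_eq_iff)
    ultimately show ?thesis
      using odd[of 1 x] by simp
  qed
  have H0: "?H (0, c) \<in> antipodal_class ` topspace (nsphere m)" if c: "c \<in> topspace ?U" for c
  proof -
    obtain x where x: "x \<in> ?A" "c = antipodal_class x"
      using c unfolding topU by blast
    have "?r (0, x) \<in> topspace ?S" "?r (0, x) (Suc m) = 0"
      using inA[of 0 x] x by (auto simp: sphere_slide_def)
    then have "?r (0, x) \<in> topspace (nsphere m)"
      using topspace_nsphere_minus1[of _ "Suc m"] by simp
    then show ?thesis
      using x(2) odd[of 0 x] by auto
  qed
  have H0_id: "?H (0, antipodal_class x) = antipodal_class x" if "x \<in> topspace (nsphere m)" for x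
  proof -
    have "?r (0, x) = x"
      using that by (auto simp: sphere_slide_def topspace_nsphere_iff fun_eq_iff)
    then show ?thesis
      using odd[of 0 x] by simp
  qed
  have E: "antipodal_class ` topspace (nsphere m) \<subseteq> punctured_projective m"
    unfolding punctured_projective_def
    by (auto simp: topspace_nsphere_iff)
  have RP: "real_projective_space m = subtopology ?U (antipodal_class ` topspace (nsphere m))"
    using E by (simp add: subtopology_subtopology Int_absorb1 real_projective_space_equator)
  have cont0: "continuous_map ?U ?U (\<lambda>c. ?H (0, c))"
    using continuous_map_o_Pair[OF contH, of 0] by (simp add: o_def)
  show ?thesis
  proof (rule deformation_retract_imp_isomorphic_homology_groups)
    show "retraction_maps ?U (real_projective_space m) (\<lambda>c. ?H (0, c)) id"
      unfolding retraction_maps_def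
    proof (intro conjI ballI)
      show "continuous_map ?U (real_projective_space m) (\<lambda>c. ?H (0, c))"
        unfolding RP using cont0 H0 by (auto simp: continuous_map_in_subtopology)
      show "continuous_map (real_projective_space m) ?U id"
        unfolding RP by (rule continuous_map_from_subtopology[OF continuous_map_id])
      show "?H (0, id c) = c" if "c \<in> topspace (real_projective_space m)" for c
        using that H0_id unfolding topspace_real_projective_space by auto
    qed
    show "homotopic_with (\<lambda>h. True) ?U ?U (\<lambda>c. ?H (0, c)) id"
    proof (subst homotopic_with, simp, intro exI conjI ballI)
      show "continuous_map (prod_topology ?I ?U) ?U ?H"
        by (rule contH)
      show "?H (1, c) = id c" if "c \<in> topspace ?U" for c
        using H1[OF that] by simp
    qed simp_all
  qed
qed

text \<open>By excision, both pairs have the relative homology of a cap around the pole and its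
  punctured cap.\<close>

lemma relative_homology_group_punctured_projective:
  "relative_homology_group p (real_projective_space (Suc m)) (punctured_projective m) \<cong>
     reduced_homology_group p (nsphere (Suc m))"
proof -
  let ?k = "Suc m" and ?q = antipodal_class
  let ?S = "nsphere ?k" and ?X = "real_projective_space ?k" and ?U = "punctured_projective m"
  let ?L = "{x. x ?k < 1}"
  \<comment> \<open>\<open>Z\<close> is the band between the heights -1/2 and 1/2, to be excised;
    every class outside it has exactly one representative in the cap \<open>W\<close>.\<close>
  define Z where "Z = ?q ` {x \<in> topspace ?S. (x ?k)\<^sup>2 \<le> 1/4}"
  define W where "W = {x. x ?k > (1/2 :: real)}"
  have neg_W: "(\<lambda>i. - x i) \<in> W \<longleftrightarrow> x ?k < - 1/2" for x
    by (auto simp: W_def)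
  have sq_iff: "y\<^sup>2 \<le> 1/4 \<longleftrightarrow> - 1/2 \<le> y \<and> y \<le> 1/2" for y :: real
    using abs_le_square_iff[of y "1/2"] by (simp add: power_divide abs_le_iff) linarith
  have in_Z: "?q x \<in> Z \<longleftrightarrow> (x ?k)\<^sup>2 \<le> 1/4" if "x \<in> topspace ?S" for x
    using that by (auto simp: Z_def antipodal_class_eq_iff)
  have topX: "topspace ?X = ?q ` topspace ?S"
    by (rule topspace_real_projective_space)
  have diff_Z: "topspace ?X - Z = ?q ` (topspace ?S \<inter> W)"
  proof
    show "?q ` (topspace ?S \<inter> W) \<subseteq> topspace ?X - Z"
      using in_Z[unfolded sq_iff] by (fastforce simp: topX W_def)
    show "topspace ?X - Z \<subseteq> ?q ` (topspace ?S \<inter> W)"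
    proof
      fix c
      assume "c \<in> topspace ?X - Z"
      then obtain x where x: "x \<in> topspace ?S" "c = ?q x" "\<not> (x ?k)\<^sup>2 \<le> 1/4"
        using in_Z unfolding topX by blast
      then have "x \<in> W \<or> (\<lambda>i. - x i) \<in> W"
        using x(3)[unfolded sq_iff] by (auto simp: neg_W W_def)
      then show "c \<in> ?q ` (topspace ?S \<inter> W)"
      proof
        assume "(\<lambda>i. - x i) \<in> W"
        then show ?thesis
          using x imageI[of "\<lambda>i. - x i" "topspace ?S \<inter> W" ?q] by simp
      qed (use x in auto)
    qed
  qed

  have "closedin ?X Z"
  proof -
    have "closed {y :: real. y\<^sup>2 \<le> 1/4}"
      by (intro closed_Collect_le continuous_intros)
    from closedin_nsphere_Collect[OF this, of ?k ?k]
    have "closedin ?S {x \<in> topspace ?S. ?q x \<in> Z}"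
      using in_Z by (simp cong: conj_cong)
    moreover have "Z \<subseteq> topspace ?X"
      by (auto simp: Z_def topX)
    ultimately show ?thesis
      using quotient_map_antipodal_class[of ?k] unfolding quotient_map_closedin by blast
  qed
  moreover have "Z \<subseteq> ?U"
    by (auto simp: Z_def antipodal_class_in_punctured)
  ultimately have "?X closure_of Z \<subseteq> ?X interior_of ?U"
    using openin_punctured_projective by (simp add: closure_of_closedin interior_of_openin)
  then have "relative_homology_group p (subtopology ?X (topspace ?X - Z)) (?U - Z) \<cong>
      relative_homology_group p (subtopology ?X (topspace ?X)) ?U"
    using openin_subset[OF openin_punctured_projective]
    by (intro is_isoI[OF homology_excision_axiom])
  then have iso_X: "relative_homology_group p (subtopology ?X (?q ` (topspace ?S \<inter> W))) (?U - Z) \<cong>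
      relative_homology_group p ?X ?U"
    by (simp add: diff_Z)

  \<comment> \<open>The matching excision on the sphere removes everything up to height 1/2 and
    leaves the same cap \<open>W\<close>.\<close>
  have "closedin ?S {x \<in> topspace ?S. x ?k \<in> {..1/2}}" "openin ?S {x \<in> topspace ?S. x ?k \<in> {..<1}}"
    by (rule closedin_nsphere_Collect openin_nsphere_Collect; simp)+
  then have "?S closure_of {x \<in> topspace ?S. x ?k \<le> 1/2} \<subseteq> ?S interior_of {x \<in> topspace ?S. x ?k < 1}"
    by (auto simp: closure_of_closedin interior_of_openin)
  then have "relative_homology_group p (subtopology ?S (topspace ?S - {x \<in> topspace ?S. x ?k \<le> 1/2}))
       ({x \<in> topspace ?S. x ?k < 1} - {x \<in> topspace ?S. x ?k \<le> 1/2}) \<cong>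
      relative_homology_group p (subtopology ?S (topspace ?S)) {x \<in> topspace ?S. x ?k < 1}"
    by (intro is_isoI[OF homology_excision_axiom]) auto
  moreover have L: "{x \<in> topspace ?S. x ?k < 1} = topspace ?S \<inter> ?L"
    and W: "topspace ?S - {x \<in> topspace ?S. x ?k \<le> 1/2} = topspace ?S \<inter> W"
    and LW: "topspace ?S \<inter> ?L - {x \<in> topspace ?S. x ?k \<le> 1/2} = topspace ?S \<inter> W \<inter> ?L"
    by (auto simp: W_def)
  ultimately have iso_S: "relative_homology_group p (subtopology ?S (topspace ?S \<inter> W)) (topspace ?S \<inter> W \<inter> ?L) \<cong>
      relative_homology_group p ?S ?L"
    by (simp only: L W LW subtopology_topspace relative_homology_group_restrict)

  have openW: "openin ?S (topspace ?S \<inter> W)"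
    using openin_nsphere_Collect[of "{1/2<..}" ?k ?k] by (simp add: W_def Int_def)
  \<comment> \<open>Antipodal points cannot both lie in \<open>W\<close>, so the open continuous map
    \<open>?q\<close> is injective there.\<close>
  have "homeomorphic_map (subtopology ?S (topspace ?S \<inter> W)) (subtopology ?X (?q ` (topspace ?S \<inter> W))) ?q"
  proof (rule bijective_open_imp_homeomorphic_map)
    show "continuous_map (subtopology ?S (topspace ?S \<inter> W)) (subtopology ?X (?q ` (topspace ?S \<inter> W))) ?q"
      using quotient_imp_continuous_map[OF quotient_map_antipodal_class]
      by (auto simp: continuous_map_in_subtopology continuous_map_from_subtopology)
    show "open_map (subtopology ?S (topspace ?S \<inter> W)) (subtopology ?X (?q ` (topspace ?S \<inter> W))) ?q"
      by (rule open_map_into_subtopology[OF open_map_from_subtopology[OF open_map_antipodal_class openW]]) auto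
    show "?q ` topspace (subtopology ?S (topspace ?S \<inter> W)) = topspace (subtopology ?X (?q ` (topspace ?S \<inter> W)))"
      by (auto simp: topX)
    show "inj_on ?q (topspace (subtopology ?S (topspace ?S \<inter> W)))"
      by (auto simp: inj_on_def antipodal_class_eq_iff W_def)
  qed
  moreover have "?q ` (topspace ?S \<inter> W \<inter> ?L) = ?U - Z"
  proof -
    have "x ?k < 1 \<longleftrightarrow> (x ?k)\<^sup>2 < 1" if "x \<in> W" for x
      using that abs_square_less_1[of "x ?k"] by (auto simp: W_def)
    then have "?q ` (topspace ?S \<inter> W \<inter> ?L) = ?U \<inter> ?q ` (topspace ?S \<inter> W)"
      by (auto simp: antipodal_class_in_punctured)
    also have "\<dots> = ?U - Z"
      using openin_subset[OF openin_punctured_projective[of m]] by (auto simp flip: diff_Z)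
    finally show ?thesis .
  qed
  ultimately have iso_cap: "relative_homology_group p (subtopology ?S (topspace ?S \<inter> W)) (topspace ?S \<inter> W \<inter> ?L) \<cong>
      relative_homology_group p (subtopology ?X (?q ` (topspace ?S \<inter> W))) (?U - Z)"
    by (intro is_isoI[OF homeomorphic_map_relative_homology_iso]) auto
  \<comment> \<open>The sphere without its north pole is contractible, so passing to homology
    relative to it gives reduced homology. The witness for nonemptiness is the south pole.\<close>
  have iso_contract: "reduced_homology_group p ?S \<cong> relative_homology_group p ?S ?L"
  proof (rule isomorphic_reduced_homology_by_contractible[OF contractible_punctured_nsphere])
    have "(\<lambda>i. if i = ?k then - 1 else 0) \<in> topspace ?S \<inter> ?L"
      by (simp add: topspace_nsphere_iff if_distrib[of "\<lambda>x. x\<^sup>2"] cong: if_cong)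
    then show "topspace ?S \<inter> ?L \<noteq> {}"
      by blast
  qed
  have "reduced_homology_group p ?S \<cong> relative_homology_group p ?X ?U"
    using iso_trans[OF iso_contract iso_trans[OF group.iso_sym[OF _ iso_S] iso_trans[OF iso_cap iso_X]]] by simp
  then show ?thesis
    by (rule group.iso_sym[OF group_reduced_homology_group])
qed

section \<open>The Euler characteristic of projective space\<close>

lemma real_projective_space_0: "\<exists>c. topspace (real_projective_space 0) = {c}"
proof -
  have "antipodal_class x = antipodal_class y" if "x \<in> topspace (nsphere 0)" "y \<in> topspace (nsphere 0)" for x y
  proof -
    have "x 0 = y 0 \<or> x 0 = - y 0" "\<forall>i>0. x i = 0 \<and> y i = 0"
      using that by (auto simp: topspace_nsphere_iff power2_eq_1_iff)
    then have "x = y \<or> x = (\<lambda>i. - y i)"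
      by (metis (no_types, lifting) ext gr0I neg_equal_0_iff_equal)
    then show ?thesis
      by (simp add: antipodal_class_eq_iff)
  qed
  then show ?thesis
    unfolding topspace_real_projective_space using in_topspace_nsphere[of 0] by blast
qed

section \<open>The long exact sequence of the punctured pair\<close>

lemma trivial_relative_homology_group_punctured_projective:
  assumes "p \<noteq> int (Suc m)"
  shows "trivial_group (relative_homology_group p (real_projective_space (Suc m)) (punctured_projective m))"
  using assms isomorphic_group_triviality[OF relative_homology_group_punctured_projective[of p m]]
  by (simp add: trivial_reduced_homology_group_nsphere)

text \<open>The two neighbouring relative groups in the long exact sequence, in degrees
  \<open>p\<close> and \<open>p + 1\<close>, vanish, and the punctured space retracts onto the
  equator.\<close>

lemma homology_group_real_projective_space_Suc:
  assumes "p \<noteq> int m" "p \<noteq> int (Suc m)"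
  shows "homology_group p (real_projective_space (Suc m)) \<cong> homology_group p (real_projective_space m)"
proof -
  let ?X = "real_projective_space (Suc m)" and ?U = "punctured_projective m"
  have "hom_induced p (subtopology ?X ?U) {} ?X {} id
      \<in> iso (homology_group p (subtopology ?X ?U)) (homology_group p ?X)"
  proof (rule very_short_exact_sequence)
    show "exact_seq ([relative_homology_group p ?X ?U, homology_group p ?X,
        homology_group p (subtopology ?X ?U), relative_homology_group (p + 1) ?X ?U],
        [hom_induced p ?X {} ?X ?U id, hom_induced p (subtopology ?X ?U) {} ?X {} id, hom_boundary (p + 1) ?X ?U])"
      using homology_exactness_axiom_2[of "p + 1" ?X ?U] homology_exactness_axiom_3[of p ?X ?U] by simp
  qed (use assms in \<open>auto intro!: trivial_relative_homology_group_punctured_projective\<close>)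
  then have "homology_group p ?X \<cong> homology_group p (subtopology ?X ?U)"
    by (metis group.iso_sym group_relative_homology_group is_isoI)
  then show ?thesis
    using homology_group_punctured_projective iso_trans by blast
qed

lemma betti_number_real_projective_space_Suc:
  assumes "k < m"
  shows "betti_number k (real_projective_space (Suc m)) = betti_number k (real_projective_space m)"
  unfolding betti_number_def
  using assms
  by (intro abelian_group_rank_iso homology_group_real_projective_space_Suc abelian_homology_group) auto

text \<open>The first two claims carry the induction for the third: vanishing above \<open>d\<close>
  makes the map into relative homology injective, and the embedding into the integers is what
  \<open>rank_exact_integer\<close> asks of the group \<open>B\<close>.\<close>

lemma homology_group_real_projective_space:
  "(\<forall>p > int d. trivial_group (homology_group p (real_projective_space d))) \<and>
   (\<exists>f. f \<in> mon (homology_group (int d) (real_projective_space d)) integer_group) \<and>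
   (\<Sum>k\<le>d. (- 1) ^ k * int (betti_number k (real_projective_space d))) = (if even d then 1 else 0)"
proof (induction d)
  case 0
  obtain c where c: "topspace (real_projective_space 0) = {c}"
    using real_projective_space_0 by blast
  obtain f where f: "f \<in> iso (homology_group 0 (real_projective_space 0)) integer_group"
    using homology_coefficients[OF c] by (auto simp: is_iso_def)
  have mon: "f \<in> mon (homology_group 0 (real_projective_space 0)) integer_group"
    using f by (simp add: mon_def iso_def bij_betw_def)
  have "\<not> trivial_group (homology_group 0 (real_projective_space 0))"
    using isomorphic_group_triviality[OF homology_coefficients[OF c]] by simp
  then have "betti_number 0 (real_projective_space 0) = 1"
    using abelian_group_rank_mon_integer_group[OF abelian_homology_group mon] by (simp add: betti_number_def)
  then show ?case
    using homology_dimension_axiom[OF c] mon by auto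
next
  case (Suc m)
  let ?X = "real_projective_space (Suc m)" and ?U = "punctured_projective m"
  let ?V = "subtopology ?X ?U" and ?p = "int (Suc m)"
  let ?C = "homology_group ?p ?X" and ?Z = "relative_homology_group ?p ?X ?U"
    and ?B = "homology_group (?p - 1) ?V" and ?E = "homology_group (?p - 1) ?X"
  let ?j = "hom_induced ?p ?X {} ?X ?U id" and ?\<delta> = "hom_boundary ?p ?X ?U"
    and ?g = "hom_induced (?p - 1) ?V {} ?X {} id"
  have trivial: "trivial_group (homology_group p ?X)" if "p > ?p" for p
  proof -
    have "trivial_group (homology_group p (real_projective_space m))"
      using Suc.IH that by auto
    then show ?thesis
      using that isomorphic_group_triviality[OF homology_group_real_projective_space_Suc[of p m]] by simp
  qed
  have 1: "exact_seq ([?B, ?Z, ?C], [?\<delta>, ?j])"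
    by (rule homology_exactness_axiom_1)
  have 2: "exact_seq ([?E, ?B, ?Z], [?g, ?\<delta>])"
    by (rule homology_exactness_axiom_2)
  \<comment> \<open>The punctured space has the homology of projective \<open>m\<close>-space, which
    vanishes in degree \<open>m + 1\<close>.\<close>
  have j: "?j \<in> mon ?C ?Z"
  proof -
    have "trivial_group (homology_group ?p ?V)"
      using Suc.IH isomorphic_group_triviality[OF homology_group_punctured_projective[of ?p m]] by simp
    moreover have "kernel ?C ?Z ?j = hom_induced ?p ?V {} ?X {} id ` carrier (homology_group ?p ?V)"
      "group_hom (homology_group ?p ?V) ?C (hom_induced ?p ?V {} ?X {} id)"
      using homology_exactness_axiom_3[of ?p ?X ?U] by simp_all
    ultimately have "kernel ?C ?Z ?j = {\<one>\<^bsub>?C\<^esub>}"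
      by (metis group_hom.image_from_trivial_group)
    moreover have "group_hom ?C ?Z ?j"
      using 1 by simp
    ultimately show ?thesis
      by (simp add: mon_def group_hom.inj_iff_trivial_ker group_hom.homh)
  qed
  \<comment> \<open>Surjectivity comes from the vanishing of the relative group in degree
    \<open>m\<close>.\<close>
  have g: "?g \<in> epi ?B ?E"
  proof -
    have "trivial_group (relative_homology_group (?p - 1) ?X ?U)"
      by (rule trivial_relative_homology_group_punctured_projective) simp
    moreover let ?i = "hom_induced (?p - 1) ?X {} ?X ?U id"
    have "kernel ?E (relative_homology_group (?p - 1) ?X ?U) ?i = ?g ` carrier ?B"
      "group_hom ?E (relative_homology_group (?p - 1) ?X ?U) ?i"
      using homology_exactness_axiom_3[of "?p - 1" ?X ?U]
      by (simp_all add: group_hom_def group_hom_axioms_def)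
    ultimately have "?g ` carrier ?B = carrier ?E"
      by (metis group_hom.kernel_to_trivial_group)
    then show ?thesis
      using 2 by (simp add: epi_def)
  qed
  obtain f where "f \<in> mon (homology_group (?p - 1) (real_projective_space m)) integer_group"
    using Suc.IH by auto
  moreover obtain h where "h \<in> iso ?B (homology_group (?p - 1) (real_projective_space m))"
    using homology_group_punctured_projective[of "?p - 1" m] by (auto simp: is_iso_def)
  ultimately have f: "f \<circ> h \<in> mon ?B integer_group"
    by (intro mon_compose[of h]) (auto simp: iso_iff_mon_epi)
  have "?Z \<cong> integer_group"
    using relative_homology_group_punctured_projective[of ?p m] reduced_homology_group_nsphere(1)[of "Suc m"]
    by (rule iso_trans)
  then obtain \<phi> where \<phi>: "\<phi> \<in> iso ?Z integer_group"
    by (auto simp: is_iso_def)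
  have "abelian_group_rank ?C + abelian_group_rank ?B = abelian_group_rank ?E + 1"
    using 1 2 by (intro rank_exact_integer[OF _ _ _ _ j _ g _ _ \<phi> f] abelian_homology_group abelian_relative_homology_group) auto
  moreover have "abelian_group_rank ?B = betti_number m (real_projective_space m)"
    using abelian_group_rank_iso[OF homology_group_punctured_projective[of "int m" m]]
    by (simp add: betti_number_def abelian_homology_group)
  ultimately have "int (betti_number (Suc m) ?X) + int (betti_number m (real_projective_space m)) =
      int (betti_number m ?X) + 1"
    by (simp add: betti_number_def)
  then have betti: "int (betti_number (Suc m) ?X) =
      int (betti_number m ?X) + 1 - int (betti_number m (real_projective_space m))"
    by simp
  \<comment> \<open>Betti numbers below degree \<open>m\<close> do not change. By
    \<open>betti\<close>, the terms in degrees \<open>m\<close> and \<open>m + 1\<close> together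
    give the old top term minus \<open>(- 1) ^ m\<close>.\<close>
  have "(\<Sum>k\<le>Suc m. (- 1) ^ k * int (betti_number k ?X)) =
      (\<Sum>k<m. (- 1) ^ k * int (betti_number k (real_projective_space m))) +
      (- 1) ^ m * int (betti_number m ?X) - (- 1) ^ m * int (betti_number (Suc m) ?X)"
    using betti_number_real_projective_space_Suc[of _ m]
    by (simp flip: lessThan_Suc_atMost)
  also have "\<dots> = (\<Sum>k\<le>m. (- 1) ^ k * int (betti_number k (real_projective_space m))) - (- 1) ^ m"
    unfolding betti by (simp add: algebra_simps flip: lessThan_Suc_atMost)
  also have "\<dots> = (if even (Suc m) then 1 else 0)"
    using Suc.IH by simp
  finally have "(\<Sum>k\<le>Suc m. (- 1) ^ k * int (betti_number k ?X)) = (if even (Suc m) then 1 else 0)" .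
  moreover have "\<phi> \<circ> ?j \<in> mon ?C integer_group"
    using \<phi> by (intro mon_compose[OF j]) (simp add: iso_iff_mon_epi)
  ultimately show ?case
    using trivial by blast
qed

lemma euler_characteristic_real_projective_space:
  "euler_characteristic (real_projective_space d) = (if even d then 1 else 0)"
proof -
  have "betti_number k (real_projective_space d) = 0" if "k > d" for k
    using that homology_group_real_projective_space[of d]
    by (simp add: betti_number_def abelian_group_rank_trivial abelian_homology_group)
  then have "euler_characteristic (real_projective_space d) =
      (\<Sum>k\<le>d. (- 1) ^ k * int (betti_number k (real_projective_space d)))"
    unfolding euler_characteristic_def
    by (intro sum.mono_neutral_left) (auto simp: not_le intro: leI)
  then show ?thesis
    using homology_group_real_projective_space[of d] by simp
qed

section \<open>The Morse polynomials\<close>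

text \<open>Multiplication by the variable makes the values agree at 0 as well. The closed form of
  \<open>M_plus\<close> and the reflections hold only for \<open>t \<noteq> 0\<close>.\<close>

lemma poly_eqI_nonzero:
  fixes p q :: "real poly"
  assumes "\<And>t. t \<noteq> 0 \<Longrightarrow> poly p t = poly q t"
  shows "p = q"
proof -
  have "[:0, 1:] * p = [:0, 1:] * q"
    using assms by (subst poly_eq_poly_eq_iff[symmetric]) (auto simp: fun_eq_iff)
  then show ?thesis
    by simp
qed

text \<open>With \<open>n = m + 2\<close>, the recursion comes from
  \<open>M\<^sup>+\<^bsub>n+1\<^esub> = (1 + 2 t) M\<^sup>+\<^bsub>n\<^esub> + ((1 + t)\<^sup>n - 1) / t\<close>, where the last quotient is
  \<open>1 + (1 + t) (\<Sum>k<n-1. (1 + t)\<^sup>k)\<close>. It makes the nonnegativity of the coefficients evident.\<close>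

fun Q_plus :: "nat \<Rightarrow> real poly" where
  "Q_plus 0 = 0"
| "Q_plus (Suc m) = [:1, 2:] * Q_plus m + P_poly (m + 2) + (\<Sum>k\<le>m. [:1, 1:] ^ k)"

lemma coeff_Q_plus_Nats: "coeff (Q_plus m) i \<in> \<nat>"
proof (induction m arbitrary: i)
  case (Suc m)
  \<comment> \<open>This serves both the factor \<open>[:1, 2:]\<close> of the recursion and the
    powers of \<open>[:1, 1:]\<close>.\<close>
  have mult: "coeff ([:1, c:] * p) j \<in> \<nat>" if "\<And>j. coeff p j \<in> \<nat>" "c \<in> \<nat>" for c :: real and p j
    using that by (cases j) (auto simp: coeff_pCons intro!: Nats_add Nats_mult)
  have sum: "(\<Sum>k\<in>I. x k) \<in> \<nat>" if "\<And>k. x k \<in> \<nat>" for I and x :: "nat \<Rightarrow> real"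
    using that by (induction I rule: infinite_finite_induct) auto
  have "coeff ([:1, 1:] ^ k :: real poly) j \<in> \<nat>" for k j
  proof (induction k arbitrary: j)
    case (Suc k)
    then show ?case
      unfolding power_Suc by (intro mult) auto
  qed (auto simp: coeff_1)
  moreover have "coeff (P_poly (m + 2)) i \<in> \<nat>"
    by (auto simp: P_poly_def coeff_sum intro!: sum)
  ultimately show ?case
    using mult[OF Suc.IH, of 2]
    by (auto simp: coeff_sum simp del: mult_pCons_left intro!: Nats_add sum)
qed auto

lemma poly_P_poly: "poly (P_poly n) t = (\<Sum>j\<le>n - 2. t ^ j)"
  by (simp add: P_poly_def poly_sum poly_monom atLeast0AtMost)

lemma M_plus_eq: "M_plus (m + 2) = P_poly (m + 2) + [:1, 1:] * Q_plus m"
proof (induction m)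
  case 0
  then show ?case
    by (simp add: M_plus_def P_poly_def)
next
  case (Suc m)
  show ?case
  proof (rule poly_eqI_nonzero)
    fix t :: real
    assume t: "t \<noteq> 0"
    have M: "2 * t\<^sup>2 * poly (M_plus (k + 2)) t = (1 + 2 * t) ^ (k + 2) - 2 * (1 + t) ^ (k + 2) + 1" for k
      using t by (simp add: poly_M_plus)
    have geom: "t * (\<Sum>k\<le>m. (1 + t) ^ k) = (1 + t) ^ Suc m - 1"
      using power_diff_1_eq[of "1 + t" "Suc m"] by (simp add: lessThan_Suc_atMost)
    have P: "poly (P_poly (Suc m + 2)) t = 1 + t * poly (P_poly (m + 2)) t"
      unfolding poly_P_poly by (simp add: sum.atMost_Suc_shift sum_distrib_left del: sum.atMost_Suc)
    let ?S = "\<Sum>k\<le>m. (1 + t) ^ k"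
    \<comment> \<open>The power \<open>(1 + t) ^ (m + 2)\<close> stays split, so that
      \<open>geom\<close> applies to its second factor and a factor \<open>1 + t\<close> remains in
      front of the sum.\<close>
    have "2 * t\<^sup>2 * poly (M_plus (Suc m + 2)) t =
        (1 + 2 * t) * (2 * t\<^sup>2 * poly (M_plus (m + 2)) t) + 2 * t * ((1 + t) * (1 + t) ^ Suc m - 1)"
      unfolding M by (simp add: algebra_simps)
    also have "(1 + t) ^ Suc m = t * ?S + 1"
      using geom by simp
    finally have "2 * t\<^sup>2 * poly (M_plus (Suc m + 2)) t =
        2 * t\<^sup>2 * ((1 + 2 * t) * poly (M_plus (m + 2)) t + (1 + t) * ?S + 1)"
      by (simp add: algebra_simps power2_eq_square)
    then have "poly (M_plus (Suc m + 2)) t = (1 + 2 * t) * poly (M_plus (m + 2)) t + (1 + t) * ?S + 1"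
      using t by simp
    \<comment> \<open>Split \<open>1 + 2 * t\<close> as \<open>t + (1 + t)\<close> in front of
      \<open>P_poly\<close>: the part with \<open>t\<close>, plus 1, is the next
      \<open>P_poly\<close>, and all the rest has the factor \<open>1 + t\<close>.\<close>
    then show "poly (M_plus (Suc m + 2)) t = poly (P_poly (Suc m + 2) + [:1, 1:] * Q_plus (Suc m)) t"
      unfolding Suc.IH poly_add poly_mult P by (simp add: poly_sum poly_power algebra_simps)
  qed
qed

text \<open>\<open>M_plus\<close> and \<open>P_poly\<close> have degree at most \<open>m\<close>,
  and the factor \<open>1 + t\<close> takes one degree. For \<open>m = 0\<close> the truncated bound
  is 0, in line with \<open>Q_plus 0 = 0\<close>.\<close>

lemma degree_Q_plus: "degree (Q_plus m) \<le> m - 1"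
proof (cases "Q_plus m = 0")
  case False
  have "degree (M_plus (m + 2)) \<le> m" "degree (P_poly (m + 2)) \<le> m"
    unfolding M_plus_def P_poly_def
    by (auto intro!: degree_sum_le order.trans[OF degree_monom_le])
  then have "degree ([:1, 1:] * Q_plus m) \<le> m"
    using degree_diff_le[of "M_plus (m + 2)" m "P_poly (m + 2)"] by (simp only: M_plus_eq) simp
  moreover have "degree ([:1, 1:] * Q_plus m) = 1 + degree (Q_plus m)"
    using False by (subst degree_mult_eq) auto
  ultimately show ?thesis
    by simp
qed simp

text \<open>Distributing \<open>t ^ n\<close> over the closed form turns each power of
  \<open>1 + c / t\<close> into one of \<open>t + c\<close>, and two of the factors \<open>t\<close>
  cancel the denominator.\<close>

lemma M_minus_reflect:
  assumes "n \<ge> 2" "t \<noteq> 0"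
  shows "poly (M_minus n) t = t ^ (n - 2) * poly (M_plus n) (inverse t)"
proof -
  have t: "t ^ n * (1 + c * inverse t) ^ n = (t + c) ^ n" for c :: real
    using assms(2) by (simp add: power_mult_distrib[symmetric] field_simps)
  have "t ^ n = t ^ (n - 2) * t\<^sup>2"
    using assms(1) le_add_diff_inverse2 power_add by metis
  then have "t ^ (n - 2) * poly (M_plus n) (inverse t) =
      (t ^ n * (1 + 2 * inverse t) ^ n - 2 * (t ^ n * (1 + 1 * inverse t) ^ n) + t ^ n) / 2"
    using assms by (simp add: poly_M_plus field_simps)
  then show ?thesis
    unfolding t using assms(1) by (simp add: poly_M_minus)
qed

text \<open>All coefficients are 1, so reversing their order changes nothing.\<close>

lemma P_poly_reflect:
  assumes "t \<noteq> 0"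
  shows "t ^ (n - 2) * poly (P_poly n) (inverse t) = poly (P_poly n) t"
proof -
  have "t ^ k * inverse t ^ j = t ^ (k - j)" if "j \<le> k" for j k
    using assms that by (simp add: power_diff power_inverse divide_inverse)
  then have "(\<Sum>j\<le>n - 2. t ^ (n - 2) * inverse t ^ j) = (\<Sum>j\<le>n - 2. t ^ (n - 2 - j))"
    by (intro sum.cong) auto
  also have "\<dots> = (\<Sum>j\<le>n - 2. t ^ j)"
    by (rule sum.reindex_bij_witness[of _ "\<lambda>j. n - 2 - j" "\<lambda>j. n - 2 - j"]) auto
  finally show ?thesis
    by (simp add: poly_P_poly sum_distrib_left)
qed

text \<open>\<open>reflect_poly\<close> reverses coefficients with respect to the actual degree; the
  monomial shifts this to a reversal with respect to \<open>m - 1\<close>.\<close>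

definition Q_minus :: "nat \<Rightarrow> real poly" where
  "Q_minus m = monom 1 (m - 1 - degree (Q_plus m)) * reflect_poly (Q_plus m)"

lemma poly_Q_minus:
  assumes "t \<noteq> 0"
  shows "poly (Q_minus m) t = t ^ (m - 1) * poly (Q_plus m) (inverse t)"
  using assms le_add_diff_inverse2[OF degree_Q_plus[of m]]
  by (simp add: Q_minus_def poly_monom poly_reflect_poly_nz del: diff_diff_left flip: power_add mult.assoc)

lemma M_minus_eq: "M_minus (m + 2) = P_poly (m + 2) + [:1, 1:] * Q_minus m"
proof (rule poly_eqI_nonzero)
  fix t :: real
  assume t: "t \<noteq> 0"
  \<comment> \<open>One factor \<open>t\<close> turns \<open>1 + inverse t\<close> into
    \<open>1 + t\<close>, which leaves \<open>t ^ (m - 1)\<close> for the cofactor. For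
    \<open>m = 0\<close> both sides are zero.\<close>
  have "t ^ m * ((1 + inverse t) * poly (Q_plus m) (inverse t)) = (1 + t) * poly (Q_minus m) t"
    using t unfolding poly_Q_minus[OF t] by (cases m) (auto simp: field_simps)
  then have "t ^ m * poly (M_plus (m + 2)) (inverse t) = poly (P_poly (m + 2)) t + (1 + t) * poly (Q_minus m) t"
    using P_poly_reflect[OF t, of "m + 2"] unfolding M_plus_eq by (simp add: algebra_simps)
  then show "poly (M_minus (m + 2)) t = poly (P_poly (m + 2) + [:1, 1:] * Q_minus m) t"
    using M_minus_reflect[of "m + 2" t] t by (simp add: algebra_simps)
qed

lemma poly_P_poly_minus_one: "poly (P_poly n) (- 1) = (if even (n - 2) then 1 else 0)"
proof -
  have "(\<Sum>j\<le>k. (- 1 :: real) ^ j) = (if even k then 1 else 0)" for k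
    by (induction k) auto
  then show ?thesis
    by (simp add: poly_P_poly)
qed

theorem corollary10p8:
  fixes n d :: nat
  assumes "n \<ge> 2" and "d = n - 2"
  shows "\<exists>Qp Qm :: real poly.
      (\<forall>i. coeff Qp i \<in> \<nat>) \<and>
      M_plus n = P_poly n + [:1, 1:] * Qp \<and>
      (n \<ge> 3 \<longrightarrow> (\<forall>t. t \<noteq> 0 \<longrightarrow> poly Qm t = t ^ (d - 1) * poly Qp (inverse t))) \<and>
      (n = 2 \<longrightarrow> Qm = 0) \<and>
      M_minus n = P_poly n + [:1, 1:] * Qm \<and>
      2 * poly Qp 1 = R_num n - real n \<and>
      2 * poly Qm 1 = R_num n - real n \<and>
      poly (M_plus n) (- 1) = of_int (euler_characteristic (real_projective_space (n - 2))) \<and>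
      poly (M_minus n) (- 1) = of_int (euler_characteristic (real_projective_space (n - 2))) \<and>
      (\<forall>t. t \<noteq> 0 \<longrightarrow> poly (M_minus n) t = t ^ (n - 2) * poly (M_plus n) (inverse t)) \<and>
      (n \<ge> 3 \<longrightarrow> (\<forall>t. t \<noteq> 0 \<longrightarrow> poly Qm t = t ^ (n - 3) * poly Qp (inverse t)))"
proof -
  have n: "n = d + 2"
    using assms by simp
  have plus: "M_plus n = P_poly n + [:1, 1:] * Q_plus d" and minus: "M_minus n = P_poly n + [:1, 1:] * Q_minus d"
    unfolding n by (rule M_plus_eq M_minus_eq)+
  \<comment> \<open>At 1 the closed form gives \<open>R_num n - 1\<close> for \<open>M_plus\<close>,
    while \<open>P_poly\<close> has the value \<open>n - 1\<close>.\<close>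
  have "2 * poly (M_plus n) 1 = 3 ^ n - 2 ^ (n + 1) + 1"
    using assms(1) by (simp add: poly_M_plus)
  moreover have "poly (M_plus n) 1 = real n - 1 + 2 * poly (Q_plus d) 1"
    unfolding plus by (simp add: poly_P_poly n)
  ultimately have Qp1: "2 * poly (Q_plus d) 1 = R_num n - real n"
    by (simp add: R_num_def field_simps)
  \<comment> \<open>The factor \<open>1 + t\<close> vanishes at -1, so only the alternating sum
    \<open>P_poly\<close> remains.\<close>
  have chi: "poly (M_plus n) (- 1) = of_int (euler_characteristic (real_projective_space (n - 2)))"
    "poly (M_minus n) (- 1) = of_int (euler_characteristic (real_projective_space (n - 2)))"
    unfolding plus minus by (simp_all add: poly_P_poly_minus_one euler_characteristic_real_projective_space)
  have Qm: "poly (Q_minus d) t = t ^ (n - 3) * poly (Q_plus d) (inverse t)" if "t \<noteq> 0" for t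
    using poly_Q_minus[OF that, of d] by (simp add: n)
  have Qm0: "Q_minus d = 0" if "n = 2"
    using that n by (simp add: Q_minus_def)
  \<comment> \<open>The point 1 is fixed by inversion, so the two cofactors agree there.\<close>
  have Qm1: "2 * poly (Q_minus d) 1 = R_num n - real n"
    using poly_Q_minus[of 1 d] Qp1 by simp
  show ?thesis
    by (intro exI[of _ "Q_plus d"] exI[of _ "Q_minus d"] conjI allI impI)
      (fact coeff_Q_plus_Nats plus minus Qp1 Qm1 chi | erule poly_Q_minus Qm0 Qm M_minus_reflect[OF assms(1)])+
qed

end
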